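(* Let $d\ge 2$. For $i=1,2,\ldots,d$ let $V_{\ell_i}^{(i)}\in\mathbb{R}^{n_i\times\ell_i}$ have $1\le\ell_i<n_i$ orthonormal columns, and let $\mathcal{B}$ denote the set of matrices of the form $$B=B^{(d)}\otimes B^{(d-1)}\otimes\cdots\otimes B^{(1)},$$ where $B^{(i)}\in\mathbb{R}^{p_i\times n_i}$ and the null space of $B^{(i)}$ contains $\mathcal{R}(V_{\ell_i}^{(i)})$ for all $i$. Define the orthogonal projectors $$P=P^{(d)}\otimes P^{(d-1)}\otimes\cdots\otimes P^{(1)},\qquad P^{(i)}=I_{n_i}-V_{\ell_i}^{(i)}V_{\ell_i}^{(i)T},\quad i=1,2,\ldots,d.$$ Let $A=A^{(d)}\otimes A^{(d-1)}\otimes\cdots\otimes A^{(1)}$ with $A^{(i)}\in\mathbb{R}^{p_i\times n_i}$, $i=1,2,\ldots,d$. Then the matrix $\widehat{A}=AP$ is a closest matrix to $A$ in $\mathcal{B}$ in the Frobenius norm; that is, $\widehat{A}\in\mathcal{B}$ and $\|A-\widehat{A}\|_F\le\|A-B\|_F$ for all $B\in\mathcal{B}$.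
   Context: $\otimes$ denotes the Kronecker product of matrices, $\mathcal{R}(M)$ denotes the range (column space) of the matrix $M$, the superscript $^T$ denotes transposition, $I_k$ is the identity matrix of order $k$, and $\|M\|_F=\sqrt{\mathrm{trace}(M^TM)}$ is the Frobenius norm. *)

theory Defs
  imports Complex_Main "Jordan_Normal_Form.Matrix_Kernel"
begin

definition kronecker :: "'a::times mat \<Rightarrow> 'a mat \<Rightarrow> 'a mat" where
  "kronecker A B = mat (dim_row A * dim_row B) (dim_col A * dim_col B)
     (\<lambda>(i, j). A $$ (i div dim_row B, j div dim_col B) * B $$ (i mod dim_row B, j mod dim_col B))"

text \<open>The family is indexed from 1 and the factors appear in decreasing order of the index:
  \<open>kronecker_prod M d\<close> is the product of \<open>M d, M (d - 1), \<dots>, M 1\<close> in this order. The value at 0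
  is the identity matrix of order 1, which is neutral for the Kronecker product.\<close>

primrec kronecker_prod :: "(nat \<Rightarrow> 'a::semiring_1 mat) \<Rightarrow> nat \<Rightarrow> 'a mat" where
  "kronecker_prod M 0 = 1\<^sub>m 1"
| "kronecker_prod M (Suc k) = kronecker (M (Suc k)) (kronecker_prod M k)"

lemma kronecker_one_right: "kronecker A (1\<^sub>m 1) = (A :: 'a::semiring_1 mat)"
  by (rule eq_matI) (auto simp: kronecker_def)

lemma kronecker_prod_1: "kronecker_prod M 1 = M 1"
  unfolding One_nat_def kronecker_prod.simps by (rule kronecker_one_right[unfolded One_nat_def])

lemma kronecker_prod_2: "kronecker_prod M 2 = kronecker (M 2) (M 1)"
  using kronecker_prod_1[of M] by (simp add: numeral_2_eq_2 del: kronecker_prod.simps(1))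

definition mat_trace :: "'a::comm_monoid_add mat \<Rightarrow> 'a" where
  "mat_trace M = (\<Sum>i<dim_row M. M $$ (i, i))"

definition frobenius_norm :: "real mat \<Rightarrow> real" where
  "frobenius_norm M = sqrt (mat_trace (M\<^sup>T * M))"

definition orthonormal_cols :: "real mat \<Rightarrow> bool" where
  "orthonormal_cols V \<longleftrightarrow>
     (\<forall>i<dim_col V. \<forall>j<dim_col V. col V i \<bullet> col V j = (if i = j then 1 else 0))"

definition range_mat :: "real mat \<Rightarrow> real vec set" where
  "range_mat V = vec_space.col_space (dim_row V) V"

definition complement_projector :: "real mat \<Rightarrow> real mat" where
  "complement_projector V = 1\<^sub>m (dim_row V) - V * V\<^sup>T"

definition kronecker_null_set ::
    "nat \<Rightarrow> (nat \<Rightarrow> nat) \<Rightarrow> (nat \<Rightarrow> nat) \<Rightarrow> (nat \<Rightarrow> real mat) \<Rightarrow> real mat set" where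
  "kronecker_null_set d p n V =
     {kronecker_prod B d | B.
        \<forall>i\<in>{1..d}. B i \<in> carrier_mat (p i) (n i) \<and> range_mat (V i) \<subseteq> mat_kernel (B i)}"

end

theory Submission
  imports Defs
begin

text \<open>Each \<open>P i\<close> is symmetric and idempotent and annihilates \<open>V i\<close>, so by the mixed product rule
  the Kronecker product \<open>P\<close> is symmetric and idempotent, and \<open>B * P = B\<close> for every admissible \<open>B\<close>.
  Hence \<open>A - B\<close> is the sum of \<open>A - A P\<close> and \<open>(A - B) P\<close>, which are orthogonal for the trace inner
  product, and Pythagoras gives the claim.\<close>

section \<open>Kronecker products: mixed product rule and transposition\<close>

lemma dim_kronecker [simp]:
  "dim_row (kronecker A B) = dim_row A * dim_row B"
  "dim_col (kronecker A B) = dim_col A * dim_col B"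
  by (simp_all add: kronecker_def)

lemma index_kronecker:
  "i < dim_row A * dim_row B \<Longrightarrow> j < dim_col A * dim_col B \<Longrightarrow>
   kronecker A B $$ (i, j) =
     A $$ (i div dim_row B, j div dim_col B) * B $$ (i mod dim_row B, j mod dim_col B)"
  by (simp add: kronecker_def)

lemma less_mult_imp_mod_less:
  fixes i m n :: nat
  shows "i < m * n \<Longrightarrow> i mod n < n"
  by (cases n) auto

text \<open>Division with remainder by \<open>n\<close> is a bijection from
  \<open>{..<m * n}\<close> onto the index pairs. This turns the inner sum of a product of two
  Kronecker matrices into a double sum.\<close>

lemma sum_div_mod_lessThan:
  fixes f :: "nat \<Rightarrow> nat \<Rightarrow> 'a::comm_monoid_add"
  shows "(\<Sum>k<m * n. f (k div n) (k mod n)) = (\<Sum>a<m. \<Sum>b<n. f a b)"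
proof -
  have "(\<Sum>a<m. \<Sum>b<n. f a b) = (\<Sum>(a, b)\<in>{..<m} \<times> {..<n}. f a b)"
    by (simp add: sum.cartesian_product)
  also have "\<dots> = (\<Sum>k<m * n. f (k div n) (k mod n))"
  proof (rule sum.reindex_bij_witness[where i = "\<lambda>k. (k div n, k mod n)" and j = "\<lambda>(a, b). a * n + b"])
    fix ab assume "ab \<in> {..<m} \<times> {..<n}"
    then obtain a b where ab: "ab = (a, b)" "a < m" "b < n" by auto
    \<comment> \<open>Strictness comes from \<open>b < n\<close>; the bound \<open>m * n\<close>
      then follows from \<open>Suc a \<le> m\<close>.\<close>
    have "a * n + b < Suc a * n" using ab by simp
    also have "\<dots> \<le> m * n" using ab by (intro mult_le_mono1) simp
    finally show "(case ab of (a, b) \<Rightarrow> a * n + b) \<in> {..<m * n}" using ab by simp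
  qed (auto simp: less_mult_imp_div_less less_mult_imp_mod_less)
  finally show ?thesis by simp
qed

text \<open>Mixed product rule: after the inner index is split into quotient and remainder, the
  double sum factors into the entries of \<open>A * C\<close> and \<open>B * D\<close>.\<close>

lemma kronecker_mult:
  fixes A B C D :: "'a::comm_semiring_0 mat"
  assumes "dim_col A = dim_row C" and "dim_col B = dim_row D"
  shows "kronecker A B * kronecker C D = kronecker (A * C) (B * D)"
proof (rule eq_matI)
  fix i j assume "i < dim_row (kronecker (A * C) (B * D))" "j < dim_col (kronecker (A * C) (B * D))"
  then have i: "i < dim_row A * dim_row B" and j: "j < dim_col C * dim_col D" by simp_all
  let ?i = "i div dim_row B" and ?i' = "i mod dim_row B"
  let ?j = "j div dim_col D" and ?j' = "j mod dim_col D"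
  have b: "?i < dim_row A" "?i' < dim_row B" "?j < dim_col C" "?j' < dim_col D"
    using i j by (simp_all add: less_mult_imp_div_less less_mult_imp_mod_less)
  have "(kronecker A B * kronecker C D) $$ (i, j) =
      (\<Sum>k<dim_row C * dim_row D. kronecker A B $$ (i, k) * kronecker C D $$ (k, j))"
    using i j assms by (simp add: scalar_prod_def lessThan_atLeast0)
  \<comment> \<open>As \<open>dim_col B = dim_row D\<close>, both Kronecker matrices split
    \<open>k\<close> in the same way, so the four factors regroup into an \<open>A\<close>,
    \<open>C\<close> part and a \<open>B\<close>, \<open>D\<close> part.\<close>
  also have "\<dots> = (\<Sum>k<dim_row C * dim_row D.
      (A $$ (?i, k div dim_row D) * C $$ (k div dim_row D, ?j)) *
      (B $$ (?i', k mod dim_row D) * D $$ (k mod dim_row D, ?j')))"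
    using i j assms by (intro sum.cong) (simp_all add: index_kronecker mult_ac)
  also have "\<dots> = (\<Sum>a<dim_row C. \<Sum>b<dim_row D.
      (A $$ (?i, a) * C $$ (a, ?j)) * (B $$ (?i', b) * D $$ (b, ?j')))"
    by (rule sum_div_mod_lessThan)
  also have "\<dots> = (A * C) $$ (?i, ?j) * (B * D) $$ (?i', ?j')"
    using b assms by (simp add: scalar_prod_def lessThan_atLeast0 sum_product)
  also have "\<dots> = kronecker (A * C) (B * D) $$ (i, j)"
    using i j by (simp add: index_kronecker)
  finally show "(kronecker A B * kronecker C D) $$ (i, j) = kronecker (A * C) (B * D) $$ (i, j)" .
qed simp_all

lemma transpose_kronecker: "(kronecker A B)\<^sup>T = kronecker A\<^sup>T B\<^sup>T"
  by (rule eq_matI)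
    (simp_all add: index_kronecker less_mult_imp_div_less less_mult_imp_mod_less)

lemma dim_kronecker_prod:
  "dim_row (kronecker_prod M d) = (\<Prod>i = 1..d. dim_row (M i))"
  "dim_col (kronecker_prod M d) = (\<Prod>i = 1..d. dim_col (M i))"
  by (induction d) simp_all

lemma kronecker_prod_carrier:
  assumes "\<And>i. i \<in> {1..d} \<Longrightarrow> M i \<in> carrier_mat (r i) (c i)"
  shows "kronecker_prod M d \<in> carrier_mat (\<Prod>i = 1..d. r i) (\<Prod>i = 1..d. c i)"
  unfolding carrier_mat_def mem_Collect_eq dim_kronecker_prod
  using assms by (intro conjI prod.cong refl) (blast dest: carrier_matD)+

text \<open>Only the factors with index in \<open>{1..d}\<close> enter the product, so factors may
  be rewritten by facts known only for these indices.\<close>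

lemma kronecker_prod_cong:
  assumes "\<And>i. i \<in> {1..d} \<Longrightarrow> M i = N i"
  shows "kronecker_prod M d = kronecker_prod N d"
  using assms by (induction d) simp_all

lemma kronecker_prod_mult:
  fixes M N :: "nat \<Rightarrow> 'a::comm_semiring_1 mat"
  assumes "\<And>i. i \<in> {1..d} \<Longrightarrow> dim_col (M i) = dim_row (N i)"
  shows "kronecker_prod M d * kronecker_prod N d = kronecker_prod (\<lambda>i. M i * N i) d"
  using assms by (induction d) (simp_all add: kronecker_mult dim_kronecker_prod)

lemma transpose_kronecker_prod:
  "(kronecker_prod M d)\<^sup>T = kronecker_prod (\<lambda>i. (M i)\<^sup>T) d"
  by (induction d) (simp_all add: transpose_kronecker)

section \<open>Complement projectors and the null space condition\<close>

lemma orthonormal_cols_iff: "orthonormal_cols V \<longleftrightarrow> V\<^sup>T * V = 1\<^sub>m (dim_col V)"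
  by (auto simp: orthonormal_cols_def mat_eq_iff)

lemma complement_projector_carrier [simp]:
  "complement_projector V \<in> carrier_mat (dim_row V) (dim_row V)"
  by (auto simp: complement_projector_def)

lemma transpose_complement_projector: "(complement_projector V)\<^sup>T = complement_projector V"
proof -
  have V: "V \<in> carrier_mat (dim_row V) (dim_col V)" by simp
  have VT: "V\<^sup>T \<in> carrier_mat (dim_col V) (dim_row V)" by simp
  show ?thesis
    unfolding complement_projector_def
    by (simp only: transpose_minus[OF one_carrier_mat mult_carrier_mat[OF V VT]]
        transpose_mult[OF V VT] transpose_one transpose_transpose)
qed

text \<open>Expanding gives \<open>B - (B * V) * V\<^sup>T\<close>, whose second term
  vanishes.\<close>

lemma mult_complement_projector:
  assumes B: "B \<in> carrier_mat r (dim_row V)" and BV: "B * V = 0\<^sub>m r (dim_col V)"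
  shows "B * complement_projector V = B"
proof -
  have V: "V \<in> carrier_mat (dim_row V) (dim_col V)" by simp
  have VT: "V\<^sup>T \<in> carrier_mat (dim_col V) (dim_row V)" by simp
  have "B * complement_projector V = B * 1\<^sub>m (dim_row V) - B * (V * V\<^sup>T)"
    unfolding complement_projector_def
    by (rule mult_minus_distrib_mat[OF B one_carrier_mat mult_carrier_mat[OF V VT]])
  also have "B * (V * V\<^sup>T) = B * V * V\<^sup>T"
    by (rule assoc_mult_mat[OF B V VT, symmetric])
  also have "\<dots> = 0\<^sub>m r (dim_row V)"
    unfolding BV by (rule left_mult_zero_mat[OF VT])
  also have "B * 1\<^sub>m (dim_row V) = B"
    by (rule right_mult_one_mat[OF B])
  also have "B - 0\<^sub>m r (dim_row V) = B"
    by (rule eq_matI) (use B in simp_all)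
  finally show ?thesis .
qed

lemma complement_projector_mult:
  assumes "orthonormal_cols V"
  shows "complement_projector V * V = 0\<^sub>m (dim_row V) (dim_col V)"
proof -
  have V: "V \<in> carrier_mat (dim_row V) (dim_col V)" by simp
  have VT: "V\<^sup>T \<in> carrier_mat (dim_col V) (dim_row V)" by simp
  have "complement_projector V * V = 1\<^sub>m (dim_row V) * V - V * V\<^sup>T * V"
    unfolding complement_projector_def
    by (rule minus_mult_distrib_mat[OF one_carrier_mat mult_carrier_mat[OF V VT] V])
  also have "V * V\<^sup>T * V = V * (V\<^sup>T * V)"
    by (rule assoc_mult_mat[OF V VT V])
  also have "V\<^sup>T * V = 1\<^sub>m (dim_col V)"
    using assms by (simp only: orthonormal_cols_iff)
  also have "1\<^sub>m (dim_row V) * V - V * 1\<^sub>m (dim_col V) = 0\<^sub>m (dim_row V) (dim_col V)"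
    by (simp only: left_mult_one_mat[OF V] right_mult_one_mat[OF V] minus_r_inv_mat[OF V])
  finally show ?thesis .
qed

text \<open>This is \<open>mult_complement_projector\<close> with the projector itself as
  \<open>B\<close>, since it annihilates \<open>V\<close>.\<close>

lemma complement_projector_idem:
  "orthonormal_cols V \<Longrightarrow> complement_projector V * complement_projector V = complement_projector V"
  by (intro mult_complement_projector[where r = "dim_row V"] complement_projector_carrier
    complement_projector_mult)

text \<open>Translates the null space condition into a matrix equation. One direction serves to show
  that the approximant is admissible, the other that admissible factors are fixed by the
  projector.\<close>

lemma range_mat_subset_kernel_iff:
  assumes B: "B \<in> carrier_mat r (dim_row V)"
  shows "range_mat V \<subseteq> mat_kernel B \<longleftrightarrow> B * V = 0\<^sub>m r (dim_col V)"
proof -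
  have V: "V \<in> carrier_mat (dim_row V) (dim_col V)" by simp
  have range: "range_mat V = {y \<in> carrier_vec (dim_row V). \<exists>x \<in> carrier_vec (dim_col V). V *\<^sub>v x = y}"
    unfolding range_mat_def by (rule vec_space.col_space_eq[OF V])
  show ?thesis
  proof
    assume sub: "range_mat V \<subseteq> mat_kernel B"
    show "B * V = 0\<^sub>m r (dim_col V)"
    proof (rule mat_col_eqI)
      fix j assume "j < dim_col (0\<^sub>m r (dim_col V) :: real mat)"
      then have j: "j < dim_col V" by simp
      \<comment> \<open>The \<open>j\<close>-th column is the image of the \<open>j\<close>-th unit
        vector, so \<open>B\<close> annihilates each column of \<open>V\<close>.\<close>
      have "V *\<^sub>v unit_vec (dim_col V) j \<in> range_mat V"
        unfolding range
        by (intro CollectI conjI bexI[where x = "unit_vec (dim_col V) j"] refl mult_mat_vec_carrier[OF V] unit_vec_carrier)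
      also have "V *\<^sub>v unit_vec (dim_col V) j = col V j"
        by (rule eq_vecI) (use j in simp_all)
      finally have "col V j \<in> mat_kernel B" using sub by (rule rev_subsetD)
      then have "B *\<^sub>v col V j = 0\<^sub>v r" by (rule mat_kernelD(2)[OF B])
      then show "col (B * V) j = col (0\<^sub>m r (dim_col V)) j"
        by (simp only: col_mult2[OF B V j] col_zero[OF j])
    qed (simp_all add: carrier_matD(1)[OF B])
  next
    assume BV: "B * V = 0\<^sub>m r (dim_col V)"
    show "range_mat V \<subseteq> mat_kernel B"
    proof
      fix y assume "y \<in> range_mat V"
      then obtain x where x: "x \<in> carrier_vec (dim_col V)" and y: "V *\<^sub>v x = y"
        and yc: "y \<in> carrier_vec (dim_row V)" unfolding range by blast
      have "B *\<^sub>v y = B * V *\<^sub>v x"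
        unfolding y[symmetric] by (rule assoc_mult_mat_vec[OF B V x, symmetric])
      also have "\<dots> = 0\<^sub>v r"
        unfolding BV by (rule eq_vecI) (use x in simp_all)
      finally show "y \<in> mat_kernel B" by (rule mat_kernelI[OF B yc])
    qed
  qed
qed

section \<open>The trace inner product and best approximation by a projection\<close>

lemma mat_trace_transpose_mult:
  fixes M N :: "'a::semiring_0 mat"
  assumes "M \<in> carrier_mat r c" "N \<in> carrier_mat r c"
  shows "mat_trace (M\<^sup>T * N) = (\<Sum>j<c. \<Sum>i<r. M $$ (i, j) * N $$ (i, j))"
  using assms by (simp add: mat_trace_def scalar_prod_def lessThan_atLeast0)

lemma mat_trace_comm:
  fixes M N :: "'a::comm_semiring_0 mat"
  assumes "M \<in> carrier_mat r c" "N \<in> carrier_mat c r"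
  shows "mat_trace (M * N) = mat_trace (N * M)"
proof -
  have "mat_trace (M * N) = (\<Sum>i<r. \<Sum>j<c. M $$ (i, j) * N $$ (j, i))"
    using assms by (simp add: mat_trace_def scalar_prod_def lessThan_atLeast0)
  also have "\<dots> = (\<Sum>j<c. \<Sum>i<r. N $$ (j, i) * M $$ (i, j))"
    by (subst sum.swap) (simp add: mult.commute)
  also have "\<dots> = mat_trace (N * M)"
    using assms by (simp add: mat_trace_def scalar_prod_def lessThan_atLeast0)
  finally show ?thesis .
qed

text \<open>In the squared norm of \<open>X + Y\<close> the cross term is twice the trace inner
  product, hence zero; what is added to the squared norm of \<open>X\<close> is a sum of
  squares.\<close>

lemma frobenius_norm_le_add_orthogonal:
  assumes X: "X \<in> carrier_mat r c" and Y: "Y \<in> carrier_mat r c"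
    and orth: "mat_trace (X\<^sup>T * Y) = 0"
  shows "frobenius_norm X \<le> frobenius_norm (X + Y)"
proof -
  have "mat_trace ((X + Y)\<^sup>T * (X + Y)) = (\<Sum>j<c. \<Sum>i<r. (X $$ (i, j) + Y $$ (i, j))\<^sup>2)"
    using X Y by (subst mat_trace_transpose_mult[where r = r and c = c]) (auto simp: power2_eq_square)
  also have "\<dots> = mat_trace (X\<^sup>T * X) + 2 * mat_trace (X\<^sup>T * Y) + mat_trace (Y\<^sup>T * Y)"
    unfolding mat_trace_transpose_mult[OF X X] mat_trace_transpose_mult[OF X Y]
      mat_trace_transpose_mult[OF Y Y]
    by (simp only: power2_sum sum.distrib sum_distrib_left) (simp add: power2_eq_square mult_ac)
  finally have "mat_trace ((X + Y)\<^sup>T * (X + Y)) = mat_trace (X\<^sup>T * X) + mat_trace (Y\<^sup>T * Y)"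
    using orth by simp
  moreover have "0 \<le> mat_trace (Y\<^sup>T * Y)"
    unfolding mat_trace_transpose_mult[OF Y Y] by (intro sum_nonneg) simp
  ultimately show ?thesis by (simp add: frobenius_norm_def)
qed

text \<open>Right multiplication by \<open>P\<close> kills \<open>X = A - A * P\<close> and fixes
  \<open>Y = A * P - B\<close>; with the symmetry of \<open>P\<close> this makes \<open>X\<close>
  and \<open>Y\<close> orthogonal.\<close>

lemma frobenius_norm_projection_le:
  assumes A: "A \<in> carrier_mat r c" and B: "B \<in> carrier_mat r c" and P: "P \<in> carrier_mat c c"
    and symm: "P\<^sup>T = P" and idem: "P * P = P" and BP: "B * P = B"
  shows "frobenius_norm (A - A * P) \<le> frobenius_norm (A - B)"
proof -
  define X Y where "X = A - A * P" and "Y = A * P - B"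
  have X: "X \<in> carrier_mat r c" and Y: "Y \<in> carrier_mat r c"
    using A B P by (auto simp: X_def Y_def)
  have APP: "A * P * P = A * P"
    using A P idem by (simp add: assoc_mult_mat[OF A P P])
  have XP: "X * P = 0\<^sub>m r c"
    unfolding X_def using A P APP minus_mult_distrib_mat[OF A mult_carrier_mat[OF A P] P]
    by (simp add: minus_r_inv_mat[OF mult_carrier_mat[OF A P]])
  have YP: "Y * P = Y"
    unfolding Y_def using minus_mult_distrib_mat[OF mult_carrier_mat[OF A P] B P] APP BP by simp
  have XT: "X\<^sup>T \<in> carrier_mat c r" using X by simp
  \<comment> \<open>A factor \<open>P\<close> is inserted on the right of \<open>Y\<close>, moved to
    the front by cyclicity of the trace, and absorbed into \<open>X * P = 0\<close>.\<close>
  have "mat_trace (X\<^sup>T * Y) = mat_trace (X\<^sup>T * Y * P)"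
    using YP assoc_mult_mat[OF XT Y P] by simp
  also have "\<dots> = mat_trace (P * (X\<^sup>T * Y))"
    by (rule mat_trace_comm[OF mult_carrier_mat[OF XT Y] P])
  also have "P * (X\<^sup>T * Y) = (X * P)\<^sup>T * Y"
    using assoc_mult_mat[OF P XT Y] transpose_mult[OF X P] symm by simp
  also have "mat_trace \<dots> = 0"
    unfolding XP using Y by (simp add: mat_trace_def)
  finally have "frobenius_norm X \<le> frobenius_norm (X + Y)"
    by (rule frobenius_norm_le_add_orthogonal[OF X Y])
  moreover have "X + Y = A - B"
    using A B P by (auto simp: X_def Y_def)
  ultimately show ?thesis by (simp add: X_def)
qed

theorem proposition3p1:
  fixes d :: nat and n p l :: "nat \<Rightarrow> nat" and V A :: "nat \<Rightarrow> real mat"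
  assumes "d \<ge> 2"
    and "\<And>i. i \<in> {1..d} \<Longrightarrow> 1 \<le> l i \<and> l i < n i"
    and "\<And>i. i \<in> {1..d} \<Longrightarrow> V i \<in> carrier_mat (n i) (l i)"
    and "\<And>i. i \<in> {1..d} \<Longrightarrow> orthonormal_cols (V i)"
    and "\<And>i. i \<in> {1..d} \<Longrightarrow> A i \<in> carrier_mat (p i) (n i)"
  shows "kronecker_prod A d * kronecker_prod (\<lambda>i. complement_projector (V i)) d
           \<in> kronecker_null_set d p n V \<and>
         (\<forall>B \<in> kronecker_null_set d p n V.
            frobenius_norm (kronecker_prod A d -
                kronecker_prod A d * kronecker_prod (\<lambda>i. complement_projector (V i)) d)
              \<le> frobenius_norm (kronecker_prod A d - B))"
proof -
  note V = assms(3) and orth = assms(4) and A = assms(5)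
  let ?P = "\<lambda>i. complement_projector (V i)"
  let ?r = "\<Prod>i = 1..d. p i" and ?c = "\<Prod>i = 1..d. n i"
  have P: "?P i \<in> carrier_mat (n i) (n i)" if "i \<in> {1..d}" for i
    using complement_projector_carrier[of "V i"] V[OF that] by simp
  have AP: "A i * ?P i \<in> carrier_mat (p i) (n i)" if "i \<in> {1..d}" for i
    using A[OF that] P[OF that] by simp
  have null: "range_mat (V i) \<subseteq> mat_kernel M \<longleftrightarrow> M * V i = 0\<^sub>m (p i) (l i)"
    if "i \<in> {1..d}" "M \<in> carrier_mat (p i) (n i)" for i M
    using range_mat_subset_kernel_iff[of M "p i" "V i"] V[OF that(1)] that(2) by simp
  have APV: "A i * ?P i * V i = 0\<^sub>m (p i) (l i)" if "i \<in> {1..d}" for i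
    using assoc_mult_mat[OF A[OF that] P[OF that] V[OF that]] A[OF that] V[OF that]
      complement_projector_mult[OF orth[OF that]] by simp
  have "kronecker_prod A d * kronecker_prod ?P d = kronecker_prod (\<lambda>i. A i * ?P i) d"
    using A P by (intro kronecker_prod_mult) (metis carrier_matD)
  \<comment> \<open>The mixed product rule exhibits the Kronecker factors \<open>A i * ?P i\<close>
    of the product; each annihilates \<open>V i\<close> because \<open>?P i\<close> does.\<close>
  then have mem: "kronecker_prod A d * kronecker_prod ?P d \<in> kronecker_null_set d p n V"
    unfolding kronecker_null_set_def using AP APV null
    by (intro CollectI exI[where x = "\<lambda>i. A i * ?P i"]) simp
  have symm: "(kronecker_prod ?P d)\<^sup>T = kronecker_prod ?P d"
    by (simp add: transpose_kronecker_prod transpose_complement_projector)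
  have "kronecker_prod ?P d * kronecker_prod ?P d = kronecker_prod (\<lambda>i. ?P i * ?P i) d"
    using P by (intro kronecker_prod_mult) (metis carrier_matD)
  also have "\<dots> = kronecker_prod ?P d"
    using orth by (intro kronecker_prod_cong complement_projector_idem)
  finally have idem: "kronecker_prod ?P d * kronecker_prod ?P d = kronecker_prod ?P d" .
  have "frobenius_norm (kronecker_prod A d - kronecker_prod A d * kronecker_prod ?P d)
      \<le> frobenius_norm (kronecker_prod A d - kronecker_prod B d)"
    if B: "\<And>i. i \<in> {1..d} \<Longrightarrow> B i \<in> carrier_mat (p i) (n i)"
      and BV: "\<And>i. i \<in> {1..d} \<Longrightarrow> range_mat (V i) \<subseteq> mat_kernel (B i)" for B
  \<comment> \<open>Besides the dimensions, it remains to show that right multiplication by the full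
    projector fixes the product of the \<open>B i\<close>, which is checked factor by
    factor.\<close>
  proof (rule frobenius_norm_projection_le[OF _ _ _ symm idem])
    have "kronecker_prod B d * kronecker_prod ?P d = kronecker_prod (\<lambda>i. B i * ?P i) d"
      using B P by (intro kronecker_prod_mult) (metis carrier_matD)
    also have "\<dots> = kronecker_prod B d"
    proof (rule kronecker_prod_cong)
      fix i assume i: "i \<in> {1..d}"
      \<comment> \<open>Through \<open>null\<close>, the kernel condition on \<open>B i\<close>
        reads \<open>B i * V i = 0\<close>.\<close>
      show "B i * ?P i = B i"
        using null[OF i B[OF i]] BV[OF i] B[OF i] V[OF i]
        by (intro mult_complement_projector[where r = "p i"]) simp_all
    qed
    finally show "kronecker_prod B d * kronecker_prod ?P d = kronecker_prod B d" .
    show "kronecker_prod A d \<in> carrier_mat ?r ?c" "kronecker_prod B d \<in> carrier_mat ?r ?c"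
      "kronecker_prod ?P d \<in> carrier_mat ?c ?c"
      by (rule kronecker_prod_carrier, erule A B P)+
  qed
  with mem show ?thesis by (auto simp: kronecker_null_set_def)
qed

end
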